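(* Let $\mathbb{L}$ be a (not necessarily commutative) ring with unity. Let $V$ be a finite set and $n=|V|$. For each $s\in V$, let $x_s\in\mathbb{L}$. Let $X,Y\in\mathbb{L}$ be such that $X+Y$ lies in the center of $\mathbb{L}$. Then \[ \sum_{S\subseteq V}X\Big(X+\sum_{s\in S}x_s\Big)^{|S|-1}\Big(Y-\sum_{s\in S}x_s\Big)^{n-|S|}=(X+Y)^n, \] where for $S=\varnothing$ the product $X\big(X+\sum_{s\in S}x_s\big)^{|S|-1}$ is interpreted as $1$. *)

theory Defs
  imports Main
begin

(* The sort {ring, monoid_mult} describes rings with unity, not necessarily commutative.
   Unlike ring_1, it does not include the axiom 0 \<noteq> 1, so the zero ring is allowed. *)

definition ring_center :: "'a :: {ring, monoid_mult} set" where
  "ring_center = {c. \<forall>z. c * z = z * c}"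

end

theory Submission
  imports Defs
begin

text \<open>
  Write \<open>c = X + Y\<close> and \<open>a\<^sub>S = X + (\<Sum>s\<in>S. x s)\<close>, so that \<open>Y - (\<Sum>s\<in>S. x s) = c - a\<^sub>S\<close>. As \<open>c\<close> is
  central, \<open>(c - a\<^sub>S)\<close> raised to \<open>card (V - S)\<close> expands binomially as a sum over \<open>W \<subseteq> V - S\<close>, and the
  coefficient of the power \<open>card W\<close> of \<open>c\<close> becomes, with \<open>U = V - W\<close>, the product of \<open>X\<close> with the
  alternating sum over \<open>S \<subseteq> U\<close> of the powers \<open>card U - 1\<close> of \<open>a\<^sub>S\<close>. Such a sum is an iterated finite
  difference of order \<open>card U\<close> of a monomial of smaller degree, so it vanishes; only \<open>W = V\<close> remains.
  Binomial coefficients are avoided by summing over subsets, since the sort at hand has no \<open>of_nat\<close>.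
\<close>

lemma sum_Pow_insert:
  assumes "finite M" "s \<notin> M"
  shows "sum f (Pow (insert s M)) = sum f (Pow M) + (\<Sum>W\<in>Pow M. f (insert s W))"
proof -
  have "inj_on (insert s) (Pow M)"
    using assms(2) by (intro inj_onI) (metis PowD insert_ident subsetD)
  moreover have "Pow M \<inter> insert s ` Pow M = {}"
    using assms(2) by auto
  ultimately show ?thesis
    using assms(1) by (simp add: Pow_insert sum.union_disjoint sum.reindex)
qed

lemma sum_Pow_containing:
  assumes "s \<in> U"
  shows "(\<Sum>S | S \<in> Pow U \<and> s \<in> S. f S) = (\<Sum>T\<in>Pow (U - {s}). f (insert s T))"
  by (rule sum.reindex_bij_witness[where i = "insert s" and j = "\<lambda>S. S - {s}"])
    (use assms in \<open>auto simp: insert_absorb\<close>)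

text \<open>A new element \<open>s\<close> outside \<open>W\<close> contributes a factor
  \<open>b\<close> on the right, one inside \<open>W\<close> a factor \<open>a\<close> on the left.
  Since \<open>b\<close> commutes with powers of \<open>a + b\<close>, both come from a single left
  factor \<open>a + b\<close>.\<close>

lemma power_add_card_commuting:
  fixes a b :: "'a :: {ring, monoid_mult}"
  assumes "finite M" and ab: "a * b = b * a"
  shows "(a + b) ^ card M = (\<Sum>W\<in>Pow M. a ^ card W * b ^ card (M - W))"
  using assms(1)
proof (induction M)
  case (insert s M)
  let ?P = "\<Sum>W\<in>Pow M. a ^ card W * b ^ card (M - W)"
  have fin: "finite W" "s \<notin> W" if "W \<in> Pow M" for W
    using that insert.hyps finite_subset by auto
  have comm: "(a + b) ^ card M * b = b * (a + b) ^ card M"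
    by (rule power_commuting_commutes) (simp add: ab distrib_left distrib_right)
  have 1: "(\<Sum>W\<in>Pow M. a ^ card W * b ^ card (insert s M - W)) = ?P * b"
    unfolding sum_distrib_right
  proof (rule sum.cong[OF refl])
    fix W assume W: "W \<in> Pow M"
    then have "insert s M - W = insert s (M - W)"
      using fin by blast
    then show "a ^ card W * b ^ card (insert s M - W) = a ^ card W * b ^ card (M - W) * b"
      using insert.hyps by (simp add: power_Suc2 mult.assoc del: power_Suc)
  qed
  have 2: "(\<Sum>W\<in>Pow M. a ^ card (insert s W) * b ^ card (insert s M - insert s W)) = a * ?P"
    unfolding sum_distrib_left
  proof (rule sum.cong[OF refl])
    fix W assume W: "W \<in> Pow M"
    then have "insert s M - insert s W = M - W"
      using insert.hyps by blast
    then show "a ^ card (insert s W) * b ^ card (insert s M - insert s W) = a * (a ^ card W * b ^ card (M - W))"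
      using fin[OF W] by (simp add: mult.assoc)
  qed
  have "(a + b) ^ card (insert s M) = ?P * b + a * ?P"
    using insert comm by (simp add: distrib_right)
  then show ?case
    using sum_Pow_insert[OF insert.hyps, of "\<lambda>W. a ^ card W * b ^ card (insert s M - W)"] 1 2 by simp
qed simp

text \<open>This is multiplication by \<open>(-1) ^ k\<close>, written as conditional negation so
  that only additive structure is required.\<close>

definition alternate :: "nat \<Rightarrow> 'a :: ab_group_add \<Rightarrow> 'a" where
  "alternate k a = (if even k then a else - a)"

lemma alternate_mult_right: "alternate k (a * b :: 'a :: ring) = a * alternate k b"
  by (simp add: alternate_def)

lemma alternate_add: "alternate k (a + b) = alternate k a + alternate k b"
  by (simp add: alternate_def)

lemma alternate_sum: "alternate k (\<Sum>i\<in>A. f i) = (\<Sum>i\<in>A. alternate k (f i))"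
  by (simp add: alternate_def sum_negf)

lemma uminus_power: "(- a) ^ k = alternate k (a ^ k)" for a :: "'a :: {ring, monoid_mult}"
  by (induction k) (auto simp: alternate_def)

text \<open>
  In the induction step the factor \<open>X + (\<Sum>s\<in>S. x s)\<close> is split off on the left; its summand \<open>x s\<close>
  leaves an alternating sum over the subsets of \<open>U - {s}\<close> with \<open>X\<close> shifted by \<open>x s\<close>.
\<close>
lemma alternating_power_sum_eq_0:
  fixes x :: "'v \<Rightarrow> 'a :: {ring, monoid_mult}"
  assumes "finite U" "m < card U"
  shows "(\<Sum>S\<in>Pow U. alternate (card (U - S)) ((X + sum x S) ^ m)) = 0"
  using assms
proof (induction m arbitrary: U X)
  case 0
  then obtain s where s: "s \<in> U"
    by (metis card_gt_0_iff ex_in_conv)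
  define M where "M = U - {s}"
  have U: "U = insert s M" "s \<notin> M" "finite M"
    using s 0 by (auto simp: M_def)
  \<comment> \<open>For exponent 0 the terms of \<open>S\<close> and \<open>insert s S\<close>
    cancel in pairs, their signs being opposite.\<close>
  have "alternate (card (U - S)) (1 :: 'a) + alternate (card (U - insert s S)) 1 = 0"
    if "S \<in> Pow M" for S
  proof -
    have "U - S = insert s (M - S)" "U - insert s S = M - S"
      using that U by auto
    then show ?thesis
      using U by (simp add: alternate_def)
  qed
  then show ?case
    using sum_Pow_insert[OF U(3,2), of "\<lambda>S. alternate (card (U - S)) (1 :: 'a)"]
    by (simp add: U(1) flip: sum.distrib)
next
  case (Suc m)
  let ?t = "\<lambda>S. alternate (card (U - S)) ((X + sum x S) ^ m)"
  have "(\<Sum>S\<in>Pow U. alternate (card (U - S)) ((X + sum x S) ^ Suc m))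
      = (\<Sum>S\<in>Pow U. X * ?t S + (\<Sum>s | s \<in> U \<and> s \<in> S. x s * ?t S))"
  proof (rule sum.cong[OF refl])
    fix S assume "S \<in> Pow U"
    then have S: "{s \<in> U. s \<in> S} = S"
      by auto
    show "alternate (card (U - S)) ((X + sum x S) ^ Suc m)
        = X * ?t S + (\<Sum>s | s \<in> U \<and> s \<in> S. x s * ?t S)"
      unfolding S by (simp add: distrib_right sum_distrib_right alternate_add alternate_sum alternate_mult_right)
  qed
  also have "\<dots> = X * (\<Sum>S\<in>Pow U. ?t S) + (\<Sum>S\<in>Pow U. \<Sum>s | s \<in> U \<and> s \<in> S. x s * ?t S)"
    by (simp add: sum.distrib sum_distrib_left)
  also have "(\<Sum>S\<in>Pow U. ?t S) = 0"
    using Suc.prems by (intro Suc.IH) auto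
  also have "(\<Sum>S\<in>Pow U. \<Sum>s | s \<in> U \<and> s \<in> S. x s * ?t S)
      = (\<Sum>s\<in>U. \<Sum>S | S \<in> Pow U \<and> s \<in> S. x s * ?t S)"
    using Suc.prems by (intro sum.swap_restrict) auto
  also have "\<dots> = (\<Sum>s\<in>U. 0)"
  proof (rule sum.cong[OF refl])
    fix s assume s: "s \<in> U"
    have "(\<Sum>S | S \<in> Pow U \<and> s \<in> S. x s * ?t S)
        = x s * (\<Sum>T\<in>Pow (U - {s}). ?t (insert s T))"
      unfolding sum_Pow_containing[OF s] sum_distrib_left ..
    also have "(\<Sum>T\<in>Pow (U - {s}). ?t (insert s T))
        = (\<Sum>T\<in>Pow (U - {s}). alternate (card (U - {s} - T)) ((X + x s + sum x T) ^ m))"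
    proof (rule sum.cong[OF refl])
      fix T assume T: "T \<in> Pow (U - {s})"
      then have "finite T" "s \<notin> T"
        using Suc.prems finite_subset by auto
      moreover have "U - insert s T = U - {s} - T"
        by auto
      ultimately show "?t (insert s T) = alternate (card (U - {s} - T)) ((X + x s + sum x T) ^ m)"
        by (simp add: add.assoc)
    qed
    \<comment> \<open>Exponent and cardinality have both dropped by one, so the strict bound
      survives for \<open>U - {s}\<close>.\<close>
    also have "\<dots> = 0"
      using Suc.prems s by (intro Suc.IH) auto
    finally show "(\<Sum>S | S \<in> Pow U \<and> s \<in> S. x s * ?t S) = 0"
      by simp
  qed
  finally show ?case
    by simp
qed

theorem theorem2p4:
  fixes V :: "'v set" and n :: nat
    and x :: "'v \<Rightarrow> 'a :: {ring, monoid_mult}" and X Y :: 'a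
  assumes "finite V" and "n = card V" and "X + Y \<in> ring_center"
  shows "(\<Sum>S\<in>Pow V.
            (if S = {} then 1 else X * (X + (\<Sum>s\<in>S. x s)) ^ (card S - 1))
              * (Y - (\<Sum>s\<in>S. x s)) ^ (n - card S))
         = (X + Y) ^ n"
proof -
  define c where "c = X + Y"
  have c: "c * z = z * c" for z
    using assms(3) by (simp add: ring_center_def c_def)
  define a where "a S = X + sum x S" for S
  define g where "g S = (if S = {} then 1 else X * a S ^ (card S - 1))" for S
  have expand: "g S * (Y - sum x S) ^ (n - card S)
      = (\<Sum>W | W \<in> Pow V \<and> S \<inter> W = {}. c ^ card W * (g S * (- a S) ^ card (V - W - S)))"
    if "S \<in> Pow V" for S
  proof -
    have S: "finite S" "S \<subseteq> V"
      using that assms(1) finite_subset by auto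
    have "(Y - sum x S) ^ (n - card S) = (c + - a S) ^ card (V - S)"
      using S assms(2) by (simp add: card_Diff_subset c_def a_def)
    also have "\<dots> = (\<Sum>W\<in>Pow (V - S). c ^ card W * (- a S) ^ card (V - S - W))"
      using assms(1) by (intro power_add_card_commuting c) auto
    also have "Pow (V - S) = {W. W \<in> Pow V \<and> S \<inter> W = {}}"
      by auto
    finally have "g S * (Y - sum x S) ^ (n - card S)
        = (\<Sum>W | W \<in> Pow V \<and> S \<inter> W = {}. g S * (c ^ card W * (- a S) ^ card (V - S - W)))"
      by (simp add: sum_distrib_left)
    \<comment> \<open>Centrality moves the power of \<open>c\<close> in front of \<open>g S\<close>,
      where it can later leave the sum over \<open>S\<close>.\<close>
    moreover have "g S * (c ^ k * z) = c ^ k * (g S * z)" for k z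
      using power_commuting_commutes[OF c, of k "g S"] by (simp flip: mult.assoc)
    moreover have "V - S - W = V - W - S" for W
      by auto
    ultimately show ?thesis
      by simp
  qed
  have vanish: "(\<Sum>S\<in>Pow U. g S * (- a S) ^ card (U - S)) = 0" if U: "finite U" "U \<noteq> {}" for U
  proof -
    have "g S * (- a S) ^ card (U - S) = X * alternate (card (U - S)) (a S ^ (card U - 1))"
      if "S \<in> Pow U" for S
    proof (cases "S = {}")
      case True
      \<comment> \<open>Here \<open>g {} = 1\<close> and \<open>a {} = X\<close>, so the convention
        for the empty set gives the same shape as the other terms, as long as \<open>card U\<close>
        is positive.\<close>
      have "X ^ card U = X * X ^ (card U - 1)"
        using U by (simp add: card_gt_0_iff flip: power_Suc)
      then show ?thesis
        using True by (simp add: g_def a_def uminus_power alternate_mult_right)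
    next
      case False
      have "finite S" "card S \<le> card U"
        using that U by (auto intro: finite_subset card_mono)
      moreover have "card S > 0"
        using False \<open>finite S\<close> by (simp add: card_gt_0_iff)
      ultimately have "card S - 1 + card (U - S) = card U - 1"
        using that by (auto simp: card_Diff_subset)
      then have "a S ^ (card S - 1) * a S ^ card (U - S) = a S ^ (card U - 1)"
        by (simp flip: power_add)
      then show ?thesis
        using False by (simp add: g_def uminus_power mult.assoc flip: alternate_mult_right)
    qed
    then have "(\<Sum>S\<in>Pow U. g S * (- a S) ^ card (U - S))
        = X * (\<Sum>S\<in>Pow U. alternate (card (U - S)) (a S ^ (card U - 1)))"
      by (simp add: sum_distrib_left)
    also have "(\<Sum>S\<in>Pow U. alternate (card (U - S)) (a S ^ (card U - 1))) = 0"
      unfolding a_def using U by (intro alternating_power_sum_eq_0) (auto simp: card_gt_0_iff)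
    finally show ?thesis
      by simp
  qed
  have "(\<Sum>S\<in>Pow V. g S * (Y - sum x S) ^ (n - card S))
      = (\<Sum>S\<in>Pow V. \<Sum>W | W \<in> Pow V \<and> S \<inter> W = {}. c ^ card W * (g S * (- a S) ^ card (V - W - S)))"
    by (intro sum.cong refl expand)
  \<comment> \<open>Summing over \<open>S\<close> first collects, for each \<open>W\<close>, the
    coefficient of \<open>c ^ card W\<close>.\<close>
  also have "\<dots> = (\<Sum>W\<in>Pow V. \<Sum>S | S \<in> Pow V \<and> S \<inter> W = {}. c ^ card W * (g S * (- a S) ^ card (V - W - S)))"
    using assms(1) by (intro sum.swap_restrict) auto
  also have "\<dots> = (\<Sum>W\<in>Pow V. if W = V then c ^ n else 0)"
  proof (rule sum.cong[OF refl])
    fix W assume W: "W \<in> Pow V"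
    have "{S. S \<in> Pow V \<and> S \<inter> W = {}} = Pow (V - W)"
      by auto
    then have eq: "(\<Sum>S | S \<in> Pow V \<and> S \<inter> W = {}. c ^ card W * (g S * (- a S) ^ card (V - W - S)))
        = c ^ card W * (\<Sum>S\<in>Pow (V - W). g S * (- a S) ^ card (V - W - S))"
      by (simp add: sum_distrib_left)
    show "(\<Sum>S | S \<in> Pow V \<and> S \<inter> W = {}. c ^ card W * (g S * (- a S) ^ card (V - W - S)))
        = (if W = V then c ^ n else 0)"
    proof (cases "W = V")
      \<comment> \<open>Only the empty \<open>S\<close> is disjoint from \<open>V\<close>, and its
        coefficient is 1.\<close>
      case True
      then show ?thesis
        unfolding eq using assms(2) by (simp add: g_def)
    next
      case False
      then show ?thesis
        unfolding eq using W assms(1) by (subst vanish) auto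
    qed
  qed
  also have "\<dots> = c ^ n"
    using assms(1) by simp
  finally show ?thesis
    unfolding g_def a_def c_def .
qed

end
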